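(* Consider the mechanical system $\mathbf M\ddot y+\mathbf C\dot y+\mathbf K y+f(y,\dot y)=\epsilon\, g(\Omega t,y,\dot y)$ with quasiperiodic forcing of frequency vector $\Omega$, its first-order form $\mathbf B\dot z=\mathbf A z+F(z)+\epsilon G(\Omega t,z)$, and the $\mathcal O(\epsilon)$ (non-autonomous) invariance equation $$\mathbf B\Big(DW(p)\,S(p,\varphi)+[\partial_pX(p,\varphi)]R(p)+[\partial_\varphi X(p,\varphi)]\Omega\Big)=\mathbf A X(p,\varphi)+[DF(W(p))]X(p,\varphi)+G(\varphi,W(p)),$$ where $W=\begin{bmatrix}w\\ \dot w\end{bmatrix}$ and $R$ solve the autonomous invariance equation $\mathbf B(DW)R=\mathbf AW+F(W)$ with leading-order terms as in the context, and $X=\begin{bmatrix}x\\ \dot x\end{bmatrix}$ and $S$ are expanded in Taylor–Fourier series with coefficients $x_{m,\kappa},\dot x_{m,\kappa}\in\mathbb C^n$, $S_{m,\kappa}\in\mathbb C^M$. Fix a multi-index $m\in\mathbb N^M$ and a harmonic $\kappa$, and let all coefficients of $x,\dot x,S$ for the harmonic $\kappa$ of order less than $|m|$ be given. Then the coefficient of $e^{i\langle\kappa,\varphi\rangle}p^m$ in the non-autonomous invariance equation can be written, after elimination of the velocity coefficient $\dot x_{m,\kappa}$, as the $n$-dimensional linear system $$\big(\mathbf K+\Lambda_{m,\kappa}\mathbf C+\Lambda_{m,\kappa}^2\mathbf M\big)x_{m,\kappa}=\mathbf D_{m,\kappa}S_{m,\kappa}+\mathbf C_{m,\kappa}.$$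 That is, for given $x_{m,\kappa}\in\mathbb C^n$ and $S_{m,\kappa}\in\mathbb C^M$, there is $\dot x_{m,\kappa}\in\mathbb C^n$ such that the $(m,\kappa)$-coefficient of the non-autonomous invariance equation holds if and only if this linear system holds. Here $\Lambda_{m,\kappa}:=\sum_{j=1}^M\lambda_jm_j+i\langle\Omega,\kappa\rangle$, $\mathbf D_{m,\kappa}\in\mathbb C^{n\times M}$ has $j$-th column $-\big(\mathbf C+(\lambda_j+\Lambda_{m,\kappa})\mathbf M\big)\phi_j$, and $\mathbf C_{m,\kappa}:=-\Lambda_{m,\kappa}\mathbf M V_{m,\kappa}-Y_{m,\kappa}\in\mathbb C^n$ with $$V_{m,\kappa}:=\sum_{j=1}^M\ \sum_{\substack{u,k\in\mathbb N^M\\ u+k-e_j=m\\ |k|<|m|}}\big(w_u\,u_j\,S^j_{k,\kappa}+x_{k,\kappa}\,k_j\,R^j_u\big),$$ $$Y_{m,\kappa}:=\mathbf M\sum_{j=1}^M\ \sum_{\substack{u,k\in\mathbb N^M\\ u+k-e_j=m\\ |k|<|m|}}\big(\dot w_u\,u_j\,S^j_{k,\kappa}+\dot x_{k,\kappa}\,k_j\,R^j_u\big)+\mathbf C V_{m,\kappa}-\sum_{\nu\in\mathbb N^{2n}}f_\nu\sum_{j=1}^{2n}\nu_j\sum_{\substack{u,h\in\mathbb N^M\\ u+h=m}}H_{\nu-e_j,h}X^j_{u,\kappa}-\sum_{\nu\in\mathbb N^{2n}}g_{\nu,\kappa}H_{\nu,m}.$$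
   Context: $\mathbf M,\mathbf C,\mathbf K\in\mathbb R^{n\times n}$ are the mass, damping and stiffness matrices, and $$z=\begin{bmatrix}y\\ \dot y\end{bmatrix},\quad \mathbf A=\begin{bmatrix}-\mathbf K&0\\0&\mathbf M\end{bmatrix},\quad \mathbf B=\begin{bmatrix}\mathbf C&\mathbf M\\ \mathbf M&0\end{bmatrix},\quad F(z)=\begin{bmatrix}-f(y,\dot y)\\0\end{bmatrix},\quad G(\varphi,z)=\begin{bmatrix}g(\varphi,y,\dot y)\\0\end{bmatrix}.$$ $\Omega\in\mathbb R^{q}$ is the frequency vector, $\varphi=\Omega t\in\mathbb T^{q}$ the forcing phase, and harmonics are $\kappa\in\mathbb Z^{q}$. The nonlinearity $f$ has no constant or linear terms. Expansions (formal): $F(z)=\sum_{\nu\in\mathbb N^{2n}}F_\nu z^\nu$ with $F_\nu=\begin{bmatrix}f_\nu\\0\end{bmatrix}$ (so $f_\nu\in\mathbb C^n$ are the Taylor coefficients of the upper block of $F$), and $G(\varphi,z)=\sum_{\nu\in\mathbb N^{2n}}\sum_{\kappa}G_{\nu,\kappa}e^{i\langle\kappa,\varphi\rangle}z^\nu$ with $G_{\nu,\kappa}=\begin{bmatrix}g_{\nu,\kappa}\\0\end{bmatrix}$. $M$ is the (even) dimension of the master spectral subspace; its eigenvalues, closed under complex conjugation, are listed as $\lambda_1,\dots,\lambda_M$, with $\phi_j\in\mathbb C^n$ satisfying $(\lambda_j^2\mathbf M+\lambda_j\mathbf C+\mathbf K)\phi_j=0$. The SSM parametrization and the reduced dynamics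 $\dot p=R_\epsilon(p,\varphi)$, $\dot\varphi=\Omega$ are expanded as $W_\epsilon=W(p)+\epsilon X(p,\varphi)+\cdots$ and $R_\epsilon=R(p)+\epsilon S(p,\varphi)+\cdots$. Here $W(p)=\sum_mW_mp^m$, $W_m=\begin{bmatrix}w_m\\ \dot w_m\end{bmatrix}$, $R(p)=\sum_mR_mp^m$, $R_m=(R^1_m,\dots,R^M_m)^T$, with $W_0=0$, $R_0=0$ and leading-order terms $w_{e_j}=\phi_j$, $\dot w_{e_j}=\lambda_j\phi_j$, $R^i_{e_j}=\delta_{ij}\lambda_j$; and $x(p,\varphi)=\sum_{m,\kappa}x_{m,\kappa}e^{i\langle\kappa,\varphi\rangle}p^m$, $\dot x(p,\varphi)=\sum_{m,\kappa}\dot x_{m,\kappa}e^{i\langle\kappa,\varphi\rangle}p^m$, $S(p,\varphi)=\sum_{m,\kappa}S_{m,\kappa}e^{i\langle\kappa,\varphi\rangle}p^m$ with $S_{m,\kappa}=(S^1_{m,\kappa},\dots,S^M_{m,\kappa})^T$. The symbols $\dot w,\dot x$ denote the velocity (second) blocks of $W,X$. $X^j_{u,\kappa}$ is the $j$-th component ($1\le j\le 2n$) of $X_{u,\kappa}=\begin{bmatrix}x_{u,\kappa}\\ \dot x_{u,\kappa}\end{bmatrix}$. Multi-indices: $\mathbb N$ includes $0$, $|m|=\sum_jm_j$, $p^m=p_1^{m_1}\cdots p_M^{m_M}$, $e_j$ is the $j$-th unit multi-index (in $\mathbb N^M$ or $\mathbb N^{2n}$ according to context), $u_j$ the $j$-th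 entry of $u$. Equations are identities of (formal) Taylor–Fourier series. $H_{\nu,h}$ ($\nu\in\mathbb N^{2n}$, $h\in\mathbb N^M$) is the coefficient of $p^h$ in $W(p)^\nu=\prod_{i=1}^{2n}W^i(p)^{\nu_i}$; terms with $\nu_j=0$ multiplying $H_{\nu-e_j,h}$ are zero. *)

theory Defs
  imports "HOL-Analysis.Analysis" "HOL-Library.Groups_Big_Fun"
begin

text \<open>Multi-indices are vectors of naturals, \<open>nat ^ 'v\<close>, with componentwise addition;
  the unit multi-index \<open>e\<^sub>j\<close> is \<^term>\<open>axis j 1 :: nat ^ 'v\<close>.\<close>

definition mdeg :: "nat ^ 'v \<Rightarrow> nat" where
  "mdeg m = (\<Sum>i\<in>UNIV. m $ i)"

definition splits :: "nat ^ 'v \<Rightarrow> ((nat ^ 'v) \<times> (nat ^ 'v)) set" where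
  "splits m = {(u, h). u + h = m}"

lemma finite_bounded_multi: "finite {u :: nat ^ 'v. \<forall>i. u $ i \<le> b}"
proof -
  have "finite {f :: 'v \<Rightarrow> nat. \<forall>i. f i \<in> {..b}}"
    using finite_PiE[of "UNIV :: 'v set" "\<lambda>_. {..b}"] by (simp add: PiE_def Pi_def)
  then have "finite (vec_lambda ` {f :: 'v \<Rightarrow> nat. \<forall>i. f i \<le> b})"
    by simp
  moreover have "{u :: nat ^ 'v. \<forall>i. u $ i \<le> b} \<subseteq> vec_lambda ` {f. \<forall>i. f i \<le> b}"
  proof
    fix u :: "nat ^ 'v" assume "u \<in> {u. \<forall>i. u $ i \<le> b}"
    then have "(\<lambda>i. u $ i) \<in> {f. \<forall>i. f i \<le> b}" "u = vec_lambda (\<lambda>i. u $ i)" by simp_all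
    then show "u \<in> vec_lambda ` {f. \<forall>i. f i \<le> b}" by blast
  qed
  ultimately show ?thesis by (rule finite_subset[rotated])
qed

lemma nth_le_mdeg: "m $ i \<le> mdeg m"
  unfolding mdeg_def by (rule member_le_sum) auto

lemma mdeg_add [simp]: "mdeg (u + h) = mdeg u + mdeg h"
  by (simp add: mdeg_def sum.distrib)

lemma mdeg_0 [simp]: "mdeg 0 = 0"
  by (simp add: mdeg_def)

lemma mdeg_eq_0_iff [simp]: "mdeg m = 0 \<longleftrightarrow> m = 0"
  by (auto simp: mdeg_def vec_eq_iff)

lemma finite_mdeg_le: "finite {m :: nat ^ 'v. mdeg m \<le> b}"
  by (rule finite_subset[OF _ finite_bounded_multi[of b]]) (auto intro: order_trans[OF nth_le_mdeg])

lemma finite_splits [simp]: "finite (splits m)"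
proof (rule finite_subset)
  show "splits m \<subseteq> {u. mdeg u \<le> mdeg m} \<times> {u. mdeg u \<le> mdeg m}"
    by (auto simp: splits_def)
  show "finite ({u. mdeg u \<le> mdeg m} \<times> {u. mdeg u \<le> mdeg m})"
    by (intro finite_cartesian_product finite_mdeg_le)
qed

typedef ('a, 'v) mfps = "UNIV :: (nat ^ 'v \<Rightarrow> 'a) set"
  morphisms coeff Mfps
  by simp

lemma coeff_Mfps [simp]: "coeff (Mfps c) = c"
  by (simp add: Mfps_inverse)

lemma mfps_eqI: "(\<And>m. coeff F m = coeff G m) \<Longrightarrow> F = G"
  by (metis coeff_inject ext)

instantiation mfps :: (comm_ring_1, finite) comm_ring_1
begin

definition zero_mfps :: "('a, 'b) mfps" where "0 = Mfps (\<lambda>_. 0)"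
definition one_mfps :: "('a, 'b) mfps" where "1 = Mfps (\<lambda>m. if m = 0 then 1 else 0)"
definition plus_mfps :: "('a, 'b) mfps \<Rightarrow> ('a, 'b) mfps \<Rightarrow> ('a, 'b) mfps"
  where "F + G = Mfps (\<lambda>m. coeff F m + coeff G m)"
definition minus_mfps :: "('a, 'b) mfps \<Rightarrow> ('a, 'b) mfps \<Rightarrow> ('a, 'b) mfps"
  where "F - G = Mfps (\<lambda>m. coeff F m - coeff G m)"
definition uminus_mfps :: "('a, 'b) mfps \<Rightarrow> ('a, 'b) mfps"
  where "- F = Mfps (\<lambda>m. - coeff F m)"
definition times_mfps :: "('a, 'b) mfps \<Rightarrow> ('a, 'b) mfps \<Rightarrow> ('a, 'b) mfps"
  where "F * G = Mfps (\<lambda>m. \<Sum>(u, h) \<in> splits m. coeff F u * coeff G h)"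

instance
proof
  fix F G H :: "('a, 'b) mfps"
  show "F * G * H = F * (G * H)"
  proof (rule mfps_eqI)
    fix m :: "nat ^ 'b"
    have "coeff (F * G * H) m =
        (\<Sum>p \<in> splits m. \<Sum>q \<in> splits (fst p). coeff F (fst q) * coeff G (snd q) * coeff H (snd p))"
      by (simp add: times_mfps_def case_prod_unfold sum_distrib_right)
    also have "\<dots> = (\<Sum>(p, q) \<in> Sigma (splits m) (\<lambda>p. splits (fst p)).
        coeff F (fst q) * coeff G (snd q) * coeff H (snd p))"
      by (simp add: sum.Sigma)
    also have "\<dots> = (\<Sum>(p, q) \<in> Sigma (splits m) (\<lambda>p. splits (snd p)).
        coeff F (fst p) * (coeff G (fst q) * coeff H (snd q)))"
      by (rule sum.reindex_bij_witness[where
            i = "\<lambda>(p, q). ((fst p + fst q, snd q), (fst p, fst q))" and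
            j = "\<lambda>(p, q). ((fst q, snd q + snd p), (snd q, snd p))"])
         (auto simp: splits_def algebra_simps)
    also have "\<dots> = coeff (F * (G * H)) m"
      by (simp add: times_mfps_def case_prod_unfold sum_distrib_left sum.Sigma)
    finally show "coeff (F * G * H) m = coeff (F * (G * H)) m" .
  qed
  show "F * G = G * F"
    unfolding times_mfps_def
    by (intro arg_cong[where f = Mfps] ext
        sum.reindex_bij_witness[where i = "\<lambda>(u, h). (h, u)" and j = "\<lambda>(u, h). (h, u)"])
       (auto simp: splits_def algebra_simps)
  show "1 * F = F"
  proof (rule mfps_eqI)
    fix m :: "nat ^ 'b"
    have "coeff (1 * F) m = (\<Sum>p \<in> splits m. (if fst p = 0 then 1 else 0) * coeff F (snd p))"
      by (simp add: times_mfps_def one_mfps_def case_prod_unfold)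
    also have "\<dots> = (\<Sum>p \<in> {(0 :: nat ^ 'b, m)}. (if fst p = 0 then 1 else 0) * coeff F (snd p))"
      by (rule sum.mono_neutral_right[OF finite_splits]) (auto simp: splits_def)
    finally show "coeff (1 * F) m = coeff F m" by simp
  qed
  show "(F + G) * H = F * H + G * H"
    by (simp add: times_mfps_def plus_mfps_def case_prod_unfold sum.distrib algebra_simps)
  have "coeff (0 :: ('a, 'b) mfps) 0 \<noteq> coeff 1 0"
    by (simp add: zero_mfps_def one_mfps_def)
  then show "(0 :: ('a, 'b) mfps) \<noteq> 1" by metis
qed (simp_all add: zero_mfps_def plus_mfps_def minus_mfps_def uminus_mfps_def coeff_inverse
       algebra_simps)

end

lemma coeff_0 [simp]: "coeff 0 m = 0"
  and coeff_1: "coeff 1 m = (if m = 0 then 1 else 0)"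
  and coeff_add [simp]: "coeff (F + G) m = coeff F m + coeff G m"
  and coeff_minus [simp]: "coeff (F - G) m = coeff F m - coeff G m"
  and coeff_uminus [simp]: "coeff (- F) m = - coeff F m"
  and coeff_mult: "coeff (F * G) m = (\<Sum>(u, h) \<in> splits m. coeff F u * coeff G h)"
  by (simp_all add: zero_mfps_def one_mfps_def plus_mfps_def minus_mfps_def uminus_mfps_def
      times_mfps_def)

definition mconst :: "'a :: comm_ring_1 \<Rightarrow> ('a, 'v :: finite) mfps" where
  "mconst c = Mfps (\<lambda>m. if m = 0 then c else 0)"

definition mpderiv :: "'v \<Rightarrow> ('a :: comm_ring_1, 'v :: finite) mfps \<Rightarrow> ('a, 'v) mfps" where
  "mpderiv j F = Mfps (\<lambda>m. of_nat (m $ j + 1) * coeff F (m + axis j 1))"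

definition jacobian :: "('a :: comm_ring_1, 'v :: finite) mfps ^ 'k \<Rightarrow> ('a, 'v) mfps ^ 'v ^ 'k" where
  "jacobian F = (\<chi> i j. mpderiv j (F $ i))"

definition mpower :: "('a :: comm_ring_1, 'v :: finite) mfps ^ 'k \<Rightarrow> nat ^ 'k \<Rightarrow> ('a, 'v) mfps" where
  "mpower W \<nu> = (\<Prod>i\<in>UNIV. (W $ i) ^ (\<nu> $ i))"

text \<open>\<open>mcompose F W\<close> is \<open>F(W(p))\<close>. For \<open>W\<close> without constant term the sum over all \<open>\<nu>\<close> has
  finitely many non-zero terms (lemma \<open>finite_mcompose_support\<close>).\<close>

definition mcompose ::
    "('a :: comm_ring_1, 'k :: finite) mfps \<Rightarrow> ('a, 'v :: finite) mfps ^ 'k \<Rightarrow> ('a, 'v) mfps" where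
  "mcompose F W = Mfps (\<lambda>h. Sum_any (\<lambda>\<nu>. coeff F \<nu> * coeff (mpower W \<nu>) h))"

lemma coeff_prod_eq_0:
  assumes "finite A" "\<And>i h. i \<in> A \<Longrightarrow> mdeg h < d i \<Longrightarrow> coeff (F i) h = 0" "mdeg h < sum d A"
  shows "coeff (\<Prod>i\<in>A. F i) h = (0 :: 'a :: comm_ring_1)"
  using assms
proof (induction A arbitrary: h rule: finite_induct)
  case (insert a A)
  have "coeff (F a) u * coeff (\<Prod>i\<in>A. F i) v = 0" if "u + v = h" for u v
  proof -
    have "mdeg u + mdeg v < d a + sum d A"
      using insert.prems insert.hyps that by auto
    then have "mdeg u < d a \<or> mdeg v < sum d A" by linarith
    then show ?thesis using insert.prems insert.IH by auto
  qed
  then show ?case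
    using insert.hyps by (auto simp: coeff_mult splits_def intro!: sum.neutral)
qed simp

lemma coeff_mpower_eq_0:
  fixes W :: "('a :: comm_ring_1, 'v :: finite) mfps ^ 'k"
  assumes "\<And>i. coeff (W $ i) 0 = 0" "mdeg h < mdeg \<nu>"
  shows "coeff (mpower W \<nu>) h = 0"
  unfolding mpower_def
proof (rule coeff_prod_eq_0[where d = "\<lambda>i. \<nu> $ i"])
  fix i and h :: "nat ^ 'v" assume "mdeg h < \<nu> $ i"
  then show "coeff ((W $ i) ^ (\<nu> $ i)) h = 0"
    using coeff_prod_eq_0[of "{..<\<nu> $ i}" "\<lambda>_. 1" "\<lambda>_. W $ i" h] assms(1) by simp
qed (use assms(2) in \<open>simp_all add: mdeg_def\<close>)

lemma finite_mcompose_support: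
  fixes W :: "('a :: comm_ring_1, 'v :: finite) mfps ^ 'k"
  assumes "\<And>i. coeff (W $ i) 0 = 0"
  shows "finite {\<nu>. coeff F \<nu> * coeff (mpower W \<nu>) h \<noteq> 0}"
proof (rule finite_subset)
  show "{\<nu>. coeff F \<nu> * coeff (mpower W \<nu>) h \<noteq> 0} \<subseteq> {\<nu>. mdeg \<nu> \<le> mdeg h}"
    using coeff_mpower_eq_0[OF assms] by (force simp: not_le[symmetric])
qed (rule finite_mdeg_le)

definition vcoeff :: "('a, 'v) mfps ^ 'k \<Rightarrow> nat ^ 'v \<Rightarrow> 'a ^ 'k" where
  "vcoeff F m = (\<chi> i. coeff (F $ i) m)"

text \<open>A Taylor--Fourier series in \<open>(p, \<phi>)\<close> is the family of its harmonics
  \<open>\<kappa> \<mapsto> (\<Sum>m. x\<^bsub>m,\<kappa>\<^esub> p\<^sup>m)\<close>. Multiplication by a series in \<open>p\<close> alone acts on each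
  harmonic separately. The phase derivative \<open>\<partial>\<^bsub>\<phi>\<^esub>\<close> in direction \<open>j\<close> multiplies
  harmonic \<open>\<kappa>\<close> by \<open>\<i> \<kappa>\<^sub>j\<close>.\<close>

type_synonym ('q, 'v, 'k) taylor_fourier = "(int, 'q) vec \<Rightarrow> ((complex, 'v) mfps, 'k) vec"

definition phase_jacobian ::
    "('q :: finite, 'v :: finite, 'k :: finite) taylor_fourier \<Rightarrow> int ^ 'q \<Rightarrow> (complex, 'v) mfps ^ 'q ^ 'k" where
  "phase_jacobian X \<kappa> = (\<chi> i j. mconst (\<i> * of_int (\<kappa> $ j)) * X \<kappa> $ i)"

definition set_tf_coeff ::
    "('q :: finite, 'v :: finite, 'k :: finite) taylor_fourier \<Rightarrow> int ^ 'q \<Rightarrow> nat ^ 'v \<Rightarrow> complex ^ 'k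
      \<Rightarrow> ('q, 'v, 'k) taylor_fourier" where
  "set_tf_coeff X \<kappa> m v = X(\<kappa> := (\<chi> i. Mfps ((coeff (X \<kappa> $ i))(m := v $ i))))"

text \<open>Index type \<open>'n + 'n\<close>: \<open>Inl\<close> for positions, \<open>Inr\<close> for velocities.\<close>

definition stack :: "'a ^ 'n \<Rightarrow> 'a ^ 'n \<Rightarrow> 'a ^ ('n + 'n)" where
  "stack a b = (\<chi> i. case i of Inl k \<Rightarrow> a $ k | Inr k \<Rightarrow> b $ k)"

definition upper :: "'a ^ ('n + 'n) \<Rightarrow> 'a ^ 'n" where
  "upper z = (\<chi> k. z $ Inl k)"

definition block :: "'a ^ 'n ^ 'n \<Rightarrow> 'a ^ 'n ^ 'n \<Rightarrow> 'a ^ 'n ^ 'n \<Rightarrow> 'a ^ 'n ^ 'n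
    \<Rightarrow> 'a ^ ('n + 'n) ^ ('n + 'n)" where
  "block P Q R S = (\<chi> i. case i of Inl k \<Rightarrow> stack (P $ k) (Q $ k) | Inr k \<Rightarrow> stack (R $ k) (S $ k))"

definition A_mat :: "real ^ 'n ^ 'n \<Rightarrow> real ^ 'n ^ 'n \<Rightarrow> real ^ ('n + 'n) ^ ('n + 'n)" where
  "A_mat M K = block (- K) 0 0 M"

definition B_mat :: "real ^ 'n ^ 'n \<Rightarrow> real ^ 'n ^ 'n \<Rightarrow> real ^ ('n + 'n) ^ ('n + 'n)" where
  "B_mat M C = block C M M 0"

abbreviation cmat :: "real ^ 'c ^ 'r \<Rightarrow> complex ^ 'c ^ 'r" where
  "cmat \<equiv> map_matrix complex_of_real"

abbreviation smat :: "real ^ 'c ^ 'r \<Rightarrow> (complex, 'v :: finite) mfps ^ 'c ^ 'r" where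
  "smat \<equiv> map_matrix (\<lambda>a. mconst (complex_of_real a))"

abbreviation scale_mat :: "complex \<Rightarrow> complex ^ 'c ^ 'r \<Rightarrow> complex ^ 'c ^ 'r" where
  "scale_mat c \<equiv> map_matrix ((*) c)"

text \<open>Here \<open>f\<close> and \<open>g\<close> are the Taylor(--Fourier) expansions in \<open>z = (y, y')\<close> of the nonlinearity
  on the left-hand side and of the forcing. Note that the upper block of \<open>F\<close> is \<open>- f\<close>.\<close>

definition F_ser :: "(complex, 'n + 'n) mfps ^ 'n \<Rightarrow> (complex, 'n + 'n) mfps ^ ('n + 'n)" where
  "F_ser f = stack (- f) 0"

definition G_ser :: "('q :: finite, 'n + 'n, 'n :: finite) taylor_fourier
    \<Rightarrow> ('q, 'n + 'n, 'n + 'n) taylor_fourier" where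
  "G_ser g = (\<lambda>\<kappa>. stack (g \<kappa>) 0)"

definition compose_vec :: "(complex, 'k :: finite) mfps ^ 'l \<Rightarrow> (complex, 'v :: finite) mfps ^ 'k
    \<Rightarrow> (complex, 'v) mfps ^ 'l" where
  "compose_vec F W = (\<chi> i. mcompose (F $ i) W)"

definition compose_mat :: "(complex, 'k :: finite) mfps ^ 'c ^ 'r \<Rightarrow> (complex, 'v :: finite) mfps ^ 'k
    \<Rightarrow> (complex, 'v) mfps ^ 'c ^ 'r" where
  "compose_mat F W = map_matrix (\<lambda>s. mcompose s W) F"

definition autonomous_invariance ::
    "real ^ 'n ^ 'n \<Rightarrow> real ^ 'n ^ 'n \<Rightarrow> real ^ 'n ^ 'n \<Rightarrow> (complex, 'n + 'n) mfps ^ 'n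
      \<Rightarrow> (complex, 'm :: finite) mfps ^ ('n + 'n) \<Rightarrow> (complex, 'm) mfps ^ 'm \<Rightarrow> bool" where
  "autonomous_invariance M C K f W R \<longleftrightarrow>
     smat (B_mat M C) *v (jacobian W *v R) = smat (A_mat M K) *v W + compose_vec (F_ser f) W"

definition nonaut_lhs ::
    "real ^ 'n ^ 'n \<Rightarrow> real ^ 'n ^ 'n \<Rightarrow> real ^ 'q
      \<Rightarrow> (complex, 'm :: finite) mfps ^ ('n + 'n) \<Rightarrow> (complex, 'm) mfps ^ 'm
      \<Rightarrow> ('q, 'm, 'n + 'n) taylor_fourier \<Rightarrow> ('q, 'm, 'm) taylor_fourier
      \<Rightarrow> ('q, 'm, 'n + 'n) taylor_fourier" where
  "nonaut_lhs M C \<Omega> W R X S = (\<lambda>\<kappa>.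
     smat (B_mat M C) *v
       (jacobian W *v S \<kappa> + jacobian (X \<kappa>) *v R
        + phase_jacobian X \<kappa> *v (\<chi> j. mconst (complex_of_real (\<Omega> $ j)))))"

definition nonaut_rhs ::
    "real ^ 'n ^ 'n \<Rightarrow> real ^ 'n ^ 'n
      \<Rightarrow> (complex, 'n + 'n) mfps ^ 'n \<Rightarrow> ('q :: finite, 'n + 'n, 'n) taylor_fourier
      \<Rightarrow> (complex, 'm :: finite) mfps ^ ('n + 'n)
      \<Rightarrow> ('q, 'm, 'n + 'n) taylor_fourier \<Rightarrow> ('q, 'm, 'n + 'n) taylor_fourier" where
  "nonaut_rhs M K f g W X = (\<lambda>\<kappa>.
     smat (A_mat M K) *v X \<kappa> + compose_mat (jacobian (F_ser f)) W *v X \<kappa>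
     + compose_vec (G_ser g \<kappa>) W)"

definition Lam :: "('m :: finite \<Rightarrow> complex) \<Rightarrow> real ^ 'q \<Rightarrow> nat ^ 'm \<Rightarrow> int ^ 'q \<Rightarrow> complex" where
  "Lam lam \<Omega> m \<kappa> = (\<Sum>j\<in>UNIV. lam j * of_nat (m $ j))
     + \<i> * complex_of_real (\<Sum>l\<in>UNIV. \<Omega> $ l * of_int (\<kappa> $ l))"

definition D_mat :: "real ^ 'n ^ 'n \<Rightarrow> real ^ 'n ^ 'n \<Rightarrow> ('m :: finite \<Rightarrow> complex)
    \<Rightarrow> ('m \<Rightarrow> complex ^ 'n) \<Rightarrow> complex \<Rightarrow> complex ^ 'm ^ 'n" where
  "D_mat M C lam \<phi> L =
     (\<chi> i j. (- ((cmat C + scale_mat (lam j + L) (cmat M)) *v \<phi> j)) $ i)"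

text \<open>The index set \<open>u + k - e\<^sub>j = m\<close>, \<open>|k| < |m|\<close>, written without truncated subtraction.\<close>

definition lower_splits :: "nat ^ 'm \<Rightarrow> 'm \<Rightarrow> ((nat ^ 'm) \<times> (nat ^ 'm)) set" where
  "lower_splits m j = {(u, k). u + k = m + axis j 1 \<and> mdeg k < mdeg m}"

lemma finite_lower_splits: "finite (lower_splits m j)"
  by (rule finite_subset[OF _ finite_splits[of "m + axis j 1"]])
     (auto simp: lower_splits_def splits_def)

text \<open>The double sum occurring twice below: with \<open>(w, x)\<close> it is \<open>V\<close>, with the velocity blocks it
  is the sum multiplied by the mass matrix in \<open>Y\<close>.\<close>

definition lower_sum :: "(complex, 'm :: finite) mfps ^ 'n \<Rightarrow> (complex, 'm) mfps ^ 'm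
    \<Rightarrow> ('q :: finite, 'm, 'n) taylor_fourier \<Rightarrow> ('q, 'm, 'm) taylor_fourier
    \<Rightarrow> nat ^ 'm \<Rightarrow> int ^ 'q \<Rightarrow> complex ^ 'n" where
  "lower_sum w R x S m \<kappa> = (\<Sum>j\<in>UNIV. \<Sum>(u, k) \<in> lower_splits m j.
     (of_nat (u $ j) * vcoeff (S \<kappa>) k $ j) *s vcoeff w u
     + (of_nat (k $ j) * vcoeff R u $ j) *s vcoeff (x \<kappa>) k)"

text \<open>\<open>f\<^bsub>\<nu>\<^esub>\<close> below is the coefficient of the upper block of \<open>F\<close>, i.e. of \<open>- f\<close>. Truncation in
  \<open>\<nu> - e\<^sub>j\<close> is harmless because of the factor \<open>\<nu>\<^sub>j\<close>.\<close>

definition Y_vec ::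
    "real ^ 'n ^ 'n \<Rightarrow> real ^ 'n ^ 'n
      \<Rightarrow> (complex, 'n + 'n) mfps ^ 'n \<Rightarrow> ('q :: finite, 'n + 'n, 'n) taylor_fourier
      \<Rightarrow> (complex, 'm :: finite) mfps ^ 'n \<Rightarrow> (complex, 'm) mfps ^ 'n \<Rightarrow> (complex, 'm) mfps ^ 'm
      \<Rightarrow> ('q, 'm, 'n) taylor_fourier \<Rightarrow> ('q, 'm, 'n) taylor_fourier \<Rightarrow> ('q, 'm, 'm) taylor_fourier
      \<Rightarrow> nat ^ 'm \<Rightarrow> int ^ 'q \<Rightarrow> complex ^ 'n" where
  "Y_vec M C f g w wd R x xd S m \<kappa> =
     (let H = (\<lambda>\<nu> h. coeff (mpower (stack w wd) \<nu>) h) in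
      cmat M *v lower_sum wd R xd S m \<kappa>
      + cmat C *v lower_sum w R x S m \<kappa>
      - Sum_any (\<lambda>\<nu>. (\<Sum>j\<in>UNIV. of_nat (\<nu> $ j) *
            (\<Sum>(u, h) \<in> splits m. H (\<nu> - axis j 1) h * vcoeff (stack (x \<kappa>) (xd \<kappa>)) u $ j))
          *s vcoeff (upper (F_ser f)) \<nu>)
      - Sum_any (\<lambda>\<nu>. H \<nu> m *s vcoeff (g \<kappa>) \<nu>))"

definition C_vec ::
    "real ^ 'n ^ 'n \<Rightarrow> real ^ 'n ^ 'n
      \<Rightarrow> (complex, 'n + 'n) mfps ^ 'n \<Rightarrow> ('q :: finite, 'n + 'n, 'n) taylor_fourier
      \<Rightarrow> (complex, 'm :: finite) mfps ^ 'n \<Rightarrow> (complex, 'm) mfps ^ 'n \<Rightarrow> (complex, 'm) mfps ^ 'm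
      \<Rightarrow> ('q, 'm, 'n) taylor_fourier \<Rightarrow> ('q, 'm, 'n) taylor_fourier \<Rightarrow> ('q, 'm, 'm) taylor_fourier
      \<Rightarrow> complex \<Rightarrow> nat ^ 'm \<Rightarrow> int ^ 'q \<Rightarrow> complex ^ 'n" where
  "C_vec M C f g w wd R x xd S L m \<kappa> =
     - (L *s (cmat M *v lower_sum w R x S m \<kappa>)) - Y_vec M C f g w wd R x xd S m \<kappa>"

end

theory Submission
  imports Defs
begin

text \<open>
  Fix the order \<open>m\<close> and the harmonic \<open>\<kappa>\<close>, and write \<open>\<Lambda>\<close> for \<open>\<Lambda>\<^bsub>m,\<kappa>\<^esub>\<close>. The differential expression
  \<open>DW S + \<partial>\<^sub>pX R + \<partial>\<^bsub>\<phi>\<^esub>X \<Omega>\<close> acts on positions and velocities separately. Of order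
  \<open>|m|\<close> or higher it meets only the coefficients of \<open>X\<close> and \<open>S\<close> with multi-index \<open>m\<close> itself: those
  of \<open>S\<close> meet the linear part of \<open>W\<close>, where \<open>\<partial>\<^sub>j\<close> keeps only the term of \<open>e\<^sub>j\<close>, and those of \<open>X\<close> meet
  the constant part of \<open>R\<close>, which is zero, or its linear part, which is diagonal
  (\<open>vcoeff_transport\<close>). With \<open>x\<close>, \<open>x'\<close> (velocity), \<open>S\<close> for the unknown coefficients,
  its blocks are therefore

  \<^item> \<open>P = V + \<Sum>\<^sub>j S\<^sup>j \<phi>\<^sub>j + \<Lambda> x\<close>,
  \<^item> \<open>P' = V' + \<Sum>\<^sub>j S\<^sup>j \<lambda>\<^sub>j \<phi>\<^sub>j + \<Lambda> x'\<close>,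

  where \<open>V\<close> and \<open>V'\<close> collect the known coefficients of lower order.

  On the right-hand side, \<open>DF(W) X\<close> does not involve the unknown coefficient of \<open>X\<close>: that
  coefficient is multiplied by the constant term of \<open>DF(W)\<close>, which vanishes because \<open>F\<close> starts
  with quadratic terms and \<open>W\<close> has no constant term (\<open>compose_jacobian_mult_cong\<close>). Denote the
  upper blocks of the coefficients of \<open>DF(W) X\<close> and \<open>G(\<phi>, W)\<close> by \<open>N\<close> and \<open>G\<^sub>m\<close>; their lower blocks
  are zero. The block structure of \<open>\<^bold>A\<close> and
  \<open>\<^bold>B\<close> turns the invariance equation into

  \<^item> \<open>C P + M P' = - K x + N + G\<^sub>m\<close>,
  \<^item> \<open>M P = M x'\<close>.

  The velocity enters the first equation only through \<open>M x'\<close>, so this product can be replaced by \<open>M P\<close>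
  even if \<open>M\<close> is singular, and conversely \<open>x' = P\<close> always solves the second equation. Collecting the
  powers of \<open>\<Lambda>\<close> in what remains gives the \<open>n\<close>-dimensional system.
\<close>

section \<open>Coefficients of derivatives and products\<close>

lemma coeff_sum: "coeff (\<Sum>i\<in>A. F i) m = (\<Sum>i\<in>A. coeff (F i) m)"
  by (induction A rule: infinite_finite_induct) auto

lemma coeff_mconst_mult:
  fixes m :: "nat ^ 'v :: finite"
  shows "coeff (mconst c * F) m = c * coeff F m"
proof -
  have "coeff (mconst c * F) m = (\<Sum>p\<in>splits m. (if fst p = 0 then c else 0) * coeff F (snd p))"
    by (simp add: coeff_mult mconst_def case_prod_unfold)
  also have "\<dots> = (\<Sum>p\<in>{(0 :: nat ^ 'v, m)}. (if fst p = 0 then c else 0) * coeff F (snd p))"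
    by (rule sum.mono_neutral_right[OF finite_splits]) (auto simp: splits_def)
  finally show ?thesis by simp
qed

lemma axis_nth_same: "axis j c $ j = c"
  by (simp add: axis_def)

lemma minus_axis_plus_axis:
  fixes u :: "nat ^ 'v"
  assumes "u $ j \<noteq> 0"
  shows "u - axis j 1 + axis j 1 = u"
  using assms by (auto simp: vec_eq_iff axis_def)

lemma mdeg_axis: "mdeg (axis j c) = c"
  by (simp add: mdeg_def axis_def)

lemma mdeg_eq_1E:
  assumes "mdeg u = 1"
  obtains j where "u = axis j 1"
proof -
  have "u \<noteq> 0" using assms by auto
  then obtain j where "u $ j \<noteq> 0" by (auto simp: vec_eq_iff)
  then have u: "u - axis j 1 + axis j 1 = u" by (rule minus_axis_plus_axis)
  then have "mdeg (u - axis j 1) + 1 = mdeg u" by (metis mdeg_add mdeg_axis)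
  then have "u - axis j 1 = 0" using assms by simp
  then show thesis using u that[of j] by simp
qed

text \<open>The Cauchy product is re-indexed by \<open>u \<mapsto> u + e\<^sub>j\<close>, which turns its summation range into the
  condition \<open>u + k - e\<^sub>j = m\<close>; the factor \<open>u\<^sub>j\<close> removes the pairs that the shift does not reach.\<close>

lemma coeff_mpderiv_mult:
  "coeff (mpderiv j F * G) m =
    (\<Sum>(u, k) \<in> splits (m + axis j 1). of_nat (u $ j) * coeff F u * coeff G k)"
proof -
  have "coeff (mpderiv j F * G) m =
      (\<Sum>(u, k) \<in> splits m. of_nat (u $ j + 1) * coeff F (u + axis j 1) * coeff G k)"
    by (simp add: coeff_mult mpderiv_def)
  also have "\<dots> = (\<Sum>(u, k) \<in> {p \<in> splits (m + axis j 1). fst p $ j \<noteq> 0}.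
      of_nat (u $ j) * coeff F u * coeff G k)"
  proof (rule sum.reindex_bij_witness[where i = "\<lambda>(u, k). (u - axis j 1, k)"
        and j = "\<lambda>(u, k). (u + axis j 1, k)"])
    fix p assume p: "p \<in> {p \<in> splits (m + axis j 1). fst p $ j \<noteq> 0}"
    obtain u k where "p = (u, k)" by fastforce
    then have eq: "u - axis j 1 + axis j 1 = u" and sum: "u + k = m + axis j 1"
      using p minus_axis_plus_axis[of u j] by (auto simp: splits_def)
    have "(u - axis j 1 + k) + axis j 1 = (u - axis j 1 + axis j 1) + k"
      by (simp only: add_ac)
    then have "u - axis j 1 + k = m" using eq sum by simp
    then show "(case p of (u, k) \<Rightarrow> (u - axis j 1, k)) \<in> splits m"
      "(case case p of (u, k) \<Rightarrow> (u - axis j 1, k) of (u, k) \<Rightarrow> (u + axis j 1, k)) = p"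
      using eq \<open>p = (u, k)\<close> by (simp_all add: splits_def)
  qed (auto simp: splits_def axis_def vec_eq_iff)
  also have "\<dots> = (\<Sum>(u, k) \<in> splits (m + axis j 1). of_nat (u $ j) * coeff F u * coeff G k)"
    by (rule sum.mono_neutral_left[OF finite_splits]) (auto intro!: gr0I)
  finally show ?thesis .
qed

text \<open>If \<open>u + k = m + e\<^sub>j\<close> and \<open>|k| \<ge> |m|\<close>, then \<open>|u| \<le> 1\<close>. So apart from the lower orders only
  \<open>u = 0\<close> and the unit multi-indices \<open>u = e\<^sub>i\<close> occur, and the hypotheses leave just \<open>u = e\<^sub>j\<close>,
  for which \<open>k = m\<close>.\<close>

lemma sum_splits_axis:
  fixes c :: "nat ^ 'v \<Rightarrow> nat ^ 'v \<Rightarrow> 'a :: comm_monoid_add"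
  assumes "\<And>k. c 0 k = 0" "\<And>i k. i \<noteq> j \<Longrightarrow> c (axis i 1) k = 0"
  shows "(\<Sum>(u, k) \<in> splits (m + axis j 1). c u k) =
    (\<Sum>(u, k) \<in> lower_splits m j. c u k) + c (axis j 1) m"
proof -
  have top: "(axis j 1, m) \<notin> lower_splits m j" by (simp add: lower_splits_def)
  have "(\<Sum>(u, k) \<in> splits (m + axis j 1). c u k) =
      (\<Sum>(u, k) \<in> insert (axis j 1, m) (lower_splits m j). c u k)"
  proof (rule sum.mono_neutral_right)
    show "insert (axis j 1, m) (lower_splits m j) \<subseteq> splits (m + axis j 1)"
      by (auto simp: splits_def lower_splits_def add.commute)
    have "c u k = 0"
      if in_splits: "(u, k) \<in> splits (m + axis j 1)" and not_top: "(u, k) \<noteq> (axis j 1, m)"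
        and not_lower: "(u, k) \<notin> lower_splits m j" for u k
    proof -
      from in_splits have eq: "u + k = m + axis j 1" by (simp add: splits_def)
      then have "mdeg u + mdeg k = mdeg m + 1" by (metis mdeg_add mdeg_axis)
      moreover have "mdeg m \<le> mdeg k" using not_lower eq by (auto simp: lower_splits_def)
      ultimately consider "mdeg u = 0" | "mdeg u = 1" by linarith
      then show ?thesis
      proof cases
        case 1
        then show ?thesis using assms(1) by simp
      next
        case 2
        then obtain i where "u = axis i 1" by (rule mdeg_eq_1E)
        moreover from this have "i \<noteq> j"
          using eq not_top by (auto simp: add.commute)
        ultimately show ?thesis using assms(2) by simp
      qed
    qed
    then show "\<forall>p \<in> splits (m + axis j 1) - insert (axis j 1, m) (lower_splits m j).
        (case p of (u, k) \<Rightarrow> c u k) = 0"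
      by auto
  qed simp
  then show ?thesis using top by (simp add: finite_lower_splits add.commute)
qed

text \<open>One block of the differential expression in the invariance equation. The contribution
  \<open>u = 0\<close> vanishes in the \<open>S\<close> part through the factor \<open>u\<^sub>j\<close> and in the \<open>R\<close> part because \<open>R\<^sub>0 = 0\<close>;
  \<open>u = e\<^sub>i\<close> with \<open>i \<noteq> j\<close> vanishes because \<open>(e\<^sub>i)\<^sub>j = 0\<close> and because the linear part of \<open>R\<close> is
  diagonal. The surviving top-order terms of the \<open>R\<close> part, \<open>m\<^sub>j \<lambda>\<^sub>j x\<^bsub>m\<^esub>\<close>, combine with the phase
  derivative \<open>\<i>\<langle>\<Omega>, \<kappa>\<rangle> x\<^bsub>m\<^esub>\<close> to the factor \<open>\<Lambda>\<^bsub>m,\<kappa>\<^esub>\<close>.\<close>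

lemma vcoeff_transport:
  fixes w :: "(complex, 'm :: finite) mfps ^ 'n"
    and x :: "('q :: finite, 'm, 'n) taylor_fourier"
    and S :: "('q, 'm, 'm) taylor_fourier"
  assumes R0: "vcoeff R 0 = 0"
    and R1: "\<And>i j. vcoeff R (axis j 1) $ i = (if i = j then lam j else 0)"
  shows "vcoeff (jacobian w *v S \<kappa> + jacobian (x \<kappa>) *v R
      + phase_jacobian x \<kappa> *v (\<chi> j. mconst (complex_of_real (\<Omega> $ j)))) m
    = lower_sum w R x S m \<kappa> + (\<Sum>j\<in>UNIV. (vcoeff (S \<kappa>) m $ j) *s vcoeff w (axis j 1))
      + Lam lam \<Omega> m \<kappa> *s vcoeff (x \<kappa>) m"
proof (rule vec_eq_iff[THEN iffD2], rule allI)
  fix i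
  have R0': "coeff (R $ j) 0 = 0" for j
    using arg_cong[OF R0, of "\<lambda>v. v $ j"] by (simp add: vcoeff_def)
  have R1': "coeff (R $ l) (axis j 1) = (if l = j then lam j else 0)" for l j
    using R1[of j l] by (simp add: vcoeff_def)
  have S_part: "coeff ((jacobian w *v S \<kappa>) $ i) m =
      (\<Sum>j\<in>UNIV. (\<Sum>(u, k) \<in> lower_splits m j.
          of_nat (u $ j) * coeff (w $ i) u * coeff (S \<kappa> $ j) k)
        + coeff (w $ i) (axis j 1) * coeff (S \<kappa> $ j) m)"
  proof -
    have "(\<Sum>(u, k) \<in> splits (m + axis j 1). of_nat (u $ j) * coeff (w $ i) u * coeff (S \<kappa> $ j) k)
        = (\<Sum>(u, k) \<in> lower_splits m j. of_nat (u $ j) * coeff (w $ i) u * coeff (S \<kappa> $ j) k)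
          + coeff (w $ i) (axis j 1) * coeff (S \<kappa> $ j) m" for j
      by (subst sum_splits_axis) (auto simp: axis_def)
    then show ?thesis
      by (simp add: matrix_vector_mult_def jacobian_def coeff_sum coeff_mpderiv_mult)
  qed
  have R_part: "coeff ((jacobian (x \<kappa>) *v R) $ i) m =
      (\<Sum>j\<in>UNIV. (\<Sum>(u, k) \<in> lower_splits m j.
          of_nat (k $ j) * coeff (R $ j) u * coeff (x \<kappa> $ i) k)
        + of_nat (m $ j) * lam j * coeff (x \<kappa> $ i) m)"
  proof -
    \<comment> \<open>Here the differentiated factor is the unknown, so the roles of \<open>u\<close> and \<open>k\<close> are exchanged.\<close>
    have "(\<Sum>(u, k) \<in> splits (m + axis j 1). of_nat (u $ j) * coeff (x \<kappa> $ i) u * coeff (R $ j) k)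
        = (\<Sum>(u, k) \<in> splits (m + axis j 1). of_nat (k $ j) * coeff (R $ j) u * coeff (x \<kappa> $ i) k)"
      for j
      by (rule sum.reindex_bij_witness[where i = "\<lambda>(u, k). (k, u)" and j = "\<lambda>(u, k). (k, u)"])
         (auto simp: splits_def add.commute)
    moreover have "(\<Sum>(u, k) \<in> splits (m + axis j 1).
          of_nat (k $ j) * coeff (R $ j) u * coeff (x \<kappa> $ i) k)
        = (\<Sum>(u, k) \<in> lower_splits m j. of_nat (k $ j) * coeff (R $ j) u * coeff (x \<kappa> $ i) k)
          + of_nat (m $ j) * lam j * coeff (x \<kappa> $ i) m" for j
      by (subst sum_splits_axis) (auto simp: R0' R1' simp del: One_nat_def)
    ultimately show ?thesis
      by (simp add: matrix_vector_mult_def jacobian_def coeff_sum coeff_mpderiv_mult)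
  qed
  have phase_part: "coeff ((phase_jacobian x \<kappa> *v (\<chi> j. mconst (complex_of_real (\<Omega> $ j)))) $ i) m
      = \<i> * complex_of_real (\<Sum>l\<in>UNIV. \<Omega> $ l * of_int (\<kappa> $ l)) * coeff (x \<kappa> $ i) m"
  proof -
    have "coeff (mconst a * F * mconst b) m = a * b * coeff F m" for a b and F :: "(complex, 'm) mfps"
      by (simp add: mult.commute[of _ "mconst b"] coeff_mconst_mult)
    then show ?thesis
      by (simp add: matrix_vector_mult_def phase_jacobian_def coeff_sum sum_distrib_left
          sum_distrib_right mult_ac)
  qed
  show "vcoeff (jacobian w *v S \<kappa> + jacobian (x \<kappa>) *v R
      + phase_jacobian x \<kappa> *v (\<chi> j. mconst (complex_of_real (\<Omega> $ j)))) m $ i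
    = (lower_sum w R x S m \<kappa> + (\<Sum>j\<in>UNIV. (vcoeff (S \<kappa>) m $ j) *s vcoeff w (axis j 1))
      + Lam lam \<Omega> m \<kappa> *s vcoeff (x \<kappa>) m) $ i"
    unfolding vcoeff_def[of "_ + _"] vec_lambda_beta vector_add_component coeff_add
      S_part R_part phase_part
    by (simp add: lower_sum_def vcoeff_def Lam_def sum.distrib case_prod_unfold
        distrib_right sum_distrib_left sum_distrib_right mult_ac)
qed

section \<open>The linearised nonlinearity\<close>

lemma mpower_coeff_0:
  assumes "\<And>i. coeff (W $ i) 0 = 0" "\<mu> \<noteq> 0"
  shows "coeff (mpower W \<mu>) 0 = 0"
  using coeff_mpower_eq_0[of W 0 \<mu>] assms by (simp add: neq0_conv[symmetric] del: neq0_conv)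

text \<open>\<open>W\<^sup>\<nu>\<close> has no terms of order below \<open>|\<nu>|\<close>, so any bound \<open>N \<ge> |h|\<close> captures all non-zero terms
  of the composition; differentiation shifts \<open>\<nu>\<close> by \<open>e\<^sub>j\<close>, hence \<open>N + 1\<close>. A range
  that does not depend on \<open>h\<close> is what allows the sums over \<open>\<nu>\<close> and over the splittings of \<open>m\<close> to be exchanged below.\<close>

lemma coeff_mcompose_mpderiv:
  assumes W0: "\<And>i. coeff (W $ i) 0 = 0" and h: "mdeg h \<le> N"
  shows "coeff (mcompose (mpderiv j F) W) h =
    (\<Sum>\<nu> \<in> {\<nu>. mdeg \<nu> \<le> N + 1}.
      of_nat (\<nu> $ j) * coeff F \<nu> * coeff (mpower W (\<nu> - axis j 1)) h)"
proof -
  have "coeff (mcompose (mpderiv j F) W) h =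
      (\<Sum>\<mu> \<in> {\<mu>. mdeg \<mu> \<le> N}.
        of_nat (\<mu> $ j + 1) * coeff F (\<mu> + axis j 1) * coeff (mpower W \<mu>) h)"
    unfolding mcompose_def mpderiv_def coeff_Mfps
  proof (rule Sum_any.expand_superset[OF finite_mdeg_le])
    show "{\<mu>. of_nat (\<mu> $ j + 1) * coeff F (\<mu> + axis j 1) * coeff (mpower W \<mu>) h \<noteq> 0}
        \<subseteq> {\<mu>. mdeg \<mu> \<le> N}"
    proof (clarify, rule ccontr)
      fix \<mu> :: "nat ^ 'a"
      assume "of_nat (\<mu> $ j + 1) * coeff F (\<mu> + axis j 1) * coeff (mpower W \<mu>) h \<noteq> 0"
        and "\<not> mdeg \<mu> \<le> N"
      then show False using coeff_mpower_eq_0[OF W0, of h \<mu>] h by simp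
    qed
  qed
  also have "\<dots> = (\<Sum>\<nu> \<in> {\<nu>. mdeg \<nu> \<le> N + 1 \<and> \<nu> $ j \<noteq> 0}.
      of_nat (\<nu> $ j) * coeff F \<nu> * coeff (mpower W (\<nu> - axis j 1)) h)"
  proof (rule sum.reindex_bij_witness[where i = "\<lambda>\<nu>. \<nu> - axis j 1" and j = "\<lambda>\<mu>. \<mu> + axis j 1"])
    fix \<nu> :: "nat ^ 'a" assume "\<nu> \<in> {\<nu>. mdeg \<nu> \<le> N + 1 \<and> \<nu> $ j \<noteq> 0}"
    then have deg: "mdeg \<nu> \<le> N + 1" and eq: "\<nu> - axis j 1 + axis j 1 = \<nu>"
      using minus_axis_plus_axis[of \<nu> j] by auto
    show "\<nu> - axis j 1 + axis j 1 = \<nu>" by (rule eq)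
    have "mdeg (\<nu> - axis j 1) + 1 = mdeg \<nu>" using eq by (metis mdeg_add mdeg_axis)
    then show "\<nu> - axis j 1 \<in> {\<mu>. mdeg \<mu> \<le> N}" using deg by simp
  qed (auto simp: axis_nth_same mdeg_axis)
  also have "\<dots> = (\<Sum>\<nu> \<in> {\<nu>. mdeg \<nu> \<le> N + 1}.
      of_nat (\<nu> $ j) * coeff F \<nu> * coeff (mpower W (\<nu> - axis j 1)) h)"
    by (rule sum.mono_neutral_left[OF finite_mdeg_le]) auto
  finally show ?thesis .
qed

text \<open>This is the expansion of \<open>DF(W) X\<close> through \<open>\<partial>\<^sub>j z\<^sup>\<nu> = \<nu>\<^sub>j z\<^bsup>\<nu> - e(j)\<^esup>\<close>, with \<open>e(j)\<close> the
  \<open>j\<close>-th unit multi-index, in the form in which it enters \<open>Y\<^bsub>m,\<kappa>\<^esub>\<close>.\<close>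

lemma vcoeff_compose_jacobian_mult:
  fixes W :: "(complex, 'v :: finite) mfps ^ 'k :: finite"
  assumes W0: "\<And>i. coeff (W $ i) 0 = 0"
  shows "vcoeff (compose_mat (jacobian F) W *v X) m =
    Sum_any (\<lambda>\<nu>. (\<Sum>j\<in>UNIV. of_nat (\<nu> $ j) *
        (\<Sum>(u, h) \<in> splits m. coeff (mpower W (\<nu> - axis j 1)) h * vcoeff X u $ j))
      *s vcoeff F \<nu>)"
    (is "_ = Sum_any ?g")
proof -
  let ?A = "{\<nu> :: nat ^ 'k. mdeg \<nu> \<le> mdeg m + 1}"
  have zero: "?g \<nu> = 0" if "\<nu> \<notin> ?A" for \<nu>
  proof -
    have "of_nat (\<nu> $ j) *
        (\<Sum>(u, h) \<in> splits m. coeff (mpower W (\<nu> - axis j 1)) h * vcoeff X u $ j) = 0" for j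
    proof (cases "\<nu> $ j = 0")
      case False
      then have "\<nu> - axis j 1 + axis j 1 = \<nu>" by (rule minus_axis_plus_axis)
      then have "mdeg (\<nu> - axis j 1) + 1 = mdeg \<nu>" by (metis mdeg_add mdeg_axis)
      then have "mdeg m < mdeg (\<nu> - axis j 1)" using that by simp
      then have "coeff (mpower W (\<nu> - axis j 1)) h = 0" if "u + h = m" for u h
        using that by (intro coeff_mpower_eq_0[OF W0]) auto
      then show ?thesis by (auto simp: splits_def intro!: sum.neutral)
    qed simp
    then have "(\<Sum>j\<in>UNIV. of_nat (\<nu> $ j) *
        (\<Sum>(u, h) \<in> splits m. coeff (mpower W (\<nu> - axis j 1)) h * vcoeff X u $ j)) = 0"
      by (intro sum.neutral) auto
    then show ?thesis by simp
  qed
  have finite_form: "Sum_any ?g = sum ?g ?A"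
    using zero by (intro Sum_any.expand_superset[OF finite_mdeg_le]) blast
  have "vcoeff (compose_mat (jacobian F) W *v X) m $ i = sum ?g ?A $ i" for i
  proof -
    have "vcoeff (compose_mat (jacobian F) W *v X) m $ i =
        (\<Sum>j\<in>UNIV. coeff (X $ j * mcompose (mpderiv j (F $ i)) W) m)"
      by (simp add: vcoeff_def matrix_vector_mult_def compose_mat_def map_matrix_def jacobian_def
          coeff_sum mult.commute)
    also have "\<dots> = (\<Sum>j\<in>UNIV. \<Sum>(u, h) \<in> splits m. \<Sum>\<nu>\<in>?A. coeff (X $ j) u *
        (of_nat (\<nu> $ j) * coeff (F $ i) \<nu> * coeff (mpower W (\<nu> - axis j 1)) h))"
      unfolding coeff_mult
    proof (intro sum.cong refl, clarify)
      fix j u h assume "(u, h) \<in> splits m"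
      then have "mdeg h \<le> mdeg m" by (auto simp: splits_def)
      then show "coeff (X $ j) u * coeff (mcompose (mpderiv j (F $ i)) W) h =
          (\<Sum>\<nu>\<in>?A. coeff (X $ j) u *
            (of_nat (\<nu> $ j) * coeff (F $ i) \<nu> * coeff (mpower W (\<nu> - axis j 1)) h))"
        by (subst coeff_mcompose_mpderiv[OF W0, of h "mdeg m"]) (auto simp: sum_distrib_left)
    qed
    also have "\<dots> = (\<Sum>j\<in>UNIV. \<Sum>\<nu>\<in>?A. \<Sum>(u, h) \<in> splits m. coeff (X $ j) u *
        (of_nat (\<nu> $ j) * coeff (F $ i) \<nu> * coeff (mpower W (\<nu> - axis j 1)) h))"
      unfolding case_prod_unfold by (intro sum.cong refl sum.swap)
    also have "\<dots> = (\<Sum>\<nu>\<in>?A. \<Sum>j\<in>UNIV. \<Sum>(u, h) \<in> splits m. coeff (X $ j) u *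
        (of_nat (\<nu> $ j) * coeff (F $ i) \<nu> * coeff (mpower W (\<nu> - axis j 1)) h))"
      by (rule sum.swap)
    also have "\<dots> = sum ?g ?A $ i"
      by (simp add: vcoeff_def case_prod_unfold sum_distrib_left sum_distrib_right mult_ac)
    finally show ?thesis .
  qed
  then show ?thesis unfolding finite_form by (simp add: vec_eq_iff)
qed

text \<open>The coefficient of \<open>X\<close> of multi-index \<open>m\<close> is paired with the constant term of
  \<open>W\<^bsup>\<nu> - e(j)\<^esup>\<close>. For \<open>|\<nu>| \<ge> 2\<close> that constant term is zero, and for \<open>|\<nu>| \<le> 1\<close> the Taylor coefficient
  of \<open>F\<close> is.\<close>

lemma compose_jacobian_mult_cong:
  fixes W :: "(complex, 'v :: finite) mfps ^ 'k :: finite"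
  assumes W0: "\<And>i. coeff (W $ i) 0 = 0" and F: "\<And>\<nu>. mdeg \<nu> \<le> 1 \<Longrightarrow> vcoeff F \<nu> = 0"
    and X: "\<And>u. u \<noteq> m \<Longrightarrow> vcoeff X u = vcoeff X' u"
  shows "vcoeff (compose_mat (jacobian F) W *v X) m = vcoeff (compose_mat (jacobian F) W *v X') m"
proof -
  have "(\<Sum>j\<in>UNIV. of_nat (\<nu> $ j) *
        (\<Sum>(u, h) \<in> splits m. coeff (mpower W (\<nu> - axis j 1)) h * vcoeff X u $ j)) *s vcoeff F \<nu>
      = (\<Sum>j\<in>UNIV. of_nat (\<nu> $ j) *
        (\<Sum>(u, h) \<in> splits m. coeff (mpower W (\<nu> - axis j 1)) h * vcoeff X' u $ j)) *s vcoeff F \<nu>"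
    for \<nu>
  proof (cases "mdeg \<nu> \<le> 1")
    case True
    then show ?thesis by (simp add: F)
  next
    case False
    have "of_nat (\<nu> $ j) * (coeff (mpower W (\<nu> - axis j 1)) h * vcoeff X u $ j) =
        of_nat (\<nu> $ j) * (coeff (mpower W (\<nu> - axis j 1)) h * vcoeff X' u $ j)"
      if "u + h = m" for j u h
    proof (cases "u = m \<and> \<nu> $ j \<noteq> 0")
      case True
      then have "h = 0" using that by simp
      have "\<nu> - axis j 1 + axis j 1 = \<nu>" using True by (intro minus_axis_plus_axis) simp
      then have "\<nu> - axis j 1 \<noteq> 0" using False by (metis add_0 mdeg_axis order_refl)
      then show ?thesis using mpower_coeff_0[OF W0] \<open>h = 0\<close> by simp
    qed (use X in auto)
    then have "(\<Sum>j\<in>UNIV. of_nat (\<nu> $ j) *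
          (\<Sum>(u, h) \<in> splits m. coeff (mpower W (\<nu> - axis j 1)) h * vcoeff X u $ j))
        = (\<Sum>j\<in>UNIV. of_nat (\<nu> $ j) *
          (\<Sum>(u, h) \<in> splits m. coeff (mpower W (\<nu> - axis j 1)) h * vcoeff X' u $ j))"
      unfolding sum_distrib_left
      by (intro sum.cong refl) (clarsimp simp only: splits_def mem_Collect_eq prod.case)
    then show ?thesis by simp
  qed
  then show ?thesis unfolding vcoeff_compose_jacobian_mult[OF W0] by (simp only:)
qed

lemma vcoeff_compose_vec:
  fixes W :: "(complex, 'v :: finite) mfps ^ 'k :: finite"
  assumes W0: "\<And>i. coeff (W $ i) 0 = 0"
  shows "vcoeff (compose_vec F W) m = Sum_any (\<lambda>\<nu>. coeff (mpower W \<nu>) m *s vcoeff F \<nu>)"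
proof -
  let ?A = "{\<nu> :: nat ^ 'k. mdeg \<nu> \<le> mdeg m}"
  have zero: "coeff (mpower W \<nu>) m = 0" if "\<nu> \<notin> ?A" for \<nu>
    using that by (intro coeff_mpower_eq_0[OF W0]) simp
  have "Sum_any (\<lambda>\<nu>. coeff (mpower W \<nu>) m *s vcoeff F \<nu>)
      = (\<Sum>\<nu>\<in>?A. coeff (mpower W \<nu>) m *s vcoeff F \<nu>)"
    using zero by (intro Sum_any.expand_superset[OF finite_mdeg_le]) auto
  moreover have "Sum_any (\<lambda>\<nu>. coeff (F $ i) \<nu> * coeff (mpower W \<nu>) m)
      = (\<Sum>\<nu>\<in>?A. coeff (F $ i) \<nu> * coeff (mpower W \<nu>) m)" for i
    using zero by (intro Sum_any.expand_superset[OF finite_mdeg_le]) auto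
  ultimately show ?thesis
    by (simp add: vec_eq_iff vcoeff_def compose_vec_def mcompose_def mult.commute)
qed

section \<open>Position and velocity blocks\<close>

lemma sum_UNIV_Plus:
  fixes h :: "'a :: finite + 'b :: finite \<Rightarrow> 'c :: comm_monoid_add"
  shows "(\<Sum>i\<in>UNIV. h i) = (\<Sum>k\<in>UNIV. h (Inl k)) + (\<Sum>k\<in>UNIV. h (Inr k))"
  by (simp add: UNIV_Plus_UNIV[symmetric] sum.Plus del: UNIV_Plus_UNIV)

lemma stack_nth [simp]: "stack a b $ Inl k = a $ k" "stack a b $ Inr k = b $ k"
  by (simp_all add: stack_def)

lemma vec_sum_eq_iff:
  "(z :: 'a ^ ('n :: finite + 'n)) = z' \<longleftrightarrow> (\<forall>k. z $ Inl k = z' $ Inl k) \<and> (\<forall>k. z $ Inr k = z' $ Inr k)"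
  by (simp add: vec_eq_iff split_sum_all)

lemma stack_eq_iff: "stack a b = stack c d \<longleftrightarrow> a = c \<and> b = d"
  by (auto simp: vec_sum_eq_iff) (simp_all add: vec_eq_iff)

lemma stack_add: "stack a b + stack c d = stack (a + c) (b + d)"
  by (simp add: vec_sum_eq_iff)

lemma block_mult_stack:
  "block P Q R S *v stack a b = stack (P *v a + Q *v b) (R *v a + S *v b)"
  by (simp add: vec_sum_eq_iff matrix_vector_mult_def block_def sum_UNIV_Plus)

lemma cmat_block:
  "cmat (block P Q R S) = block (cmat P) (cmat Q) (cmat R) (cmat S)"
  by (auto simp: vec_eq_iff map_matrix_def block_def stack_def split: sum.split)

lemma jacobian_stack_mult: "jacobian (stack a b) *v r = stack (jacobian a *v r) (jacobian b *v r)"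
  by (simp add: vec_sum_eq_iff matrix_vector_mult_def jacobian_def)

lemma phase_jacobian_stack_mult:
  "phase_jacobian (\<lambda>\<kappa>. stack (x \<kappa>) (xd \<kappa>)) \<kappa> *v r
    = stack (phase_jacobian x \<kappa> *v r) (phase_jacobian xd \<kappa> *v r)"
  by (simp add: vec_sum_eq_iff matrix_vector_mult_def phase_jacobian_def)

lemma compose_vec_stack: "compose_vec (stack a b) W = stack (compose_vec a W) (compose_vec b W)"
  by (simp add: vec_sum_eq_iff compose_vec_def)

lemma compose_jacobian_stack_mult:
  "compose_mat (jacobian (stack a b)) W *v X
    = stack (compose_mat (jacobian a) W *v X) (compose_mat (jacobian b) W *v X)"
  by (simp add: vec_sum_eq_iff matrix_vector_mult_def compose_mat_def map_matrix_def jacobian_def)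

lemma vcoeff_stack: "vcoeff (stack a b) m = stack (vcoeff a m) (vcoeff b m)"
  by (simp add: vec_sum_eq_iff vcoeff_def)

lemma upper_stack [simp]: "upper (stack a b) = a"
  by (simp add: upper_def vec_eq_iff)

lemma vcoeff_add [simp]: "vcoeff (F + G) m = vcoeff F m + vcoeff G m"
  by (simp add: vcoeff_def vec_eq_iff)

lemma vcoeff_zero: "vcoeff 0 m = 0"
  by (simp add: vcoeff_def vec_eq_iff)

lemma cmat_zero_mult: "cmat 0 *v v = 0"
  by (simp add: vec_eq_iff matrix_vector_mult_def map_matrix_def)

lemma cmat_uminus_mult: "cmat (- A) *v v = - (cmat A *v v)"
  by (simp add: vec_eq_iff matrix_vector_mult_def map_matrix_def sum_negf)

lemma vcoeff_smat_mult: "vcoeff (smat A *v F) m = cmat A *v vcoeff F m"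
  by (simp add: vec_eq_iff vcoeff_def matrix_vector_mult_def map_matrix_def coeff_sum
      coeff_mconst_mult)

lemma compose_zero:
  "compose_vec 0 W = 0" "compose_mat (jacobian 0) W = 0"
  by (simp_all add: vec_eq_iff compose_vec_def compose_mat_def map_matrix_def jacobian_def
      mcompose_def mpderiv_def zero_mfps_def)

section \<open>Elimination of the velocity coefficient\<close>

lemma vcoeff_set_tf_coeff:
  "vcoeff (set_tf_coeff X \<kappa> m v \<kappa>) u = (if u = m then v else vcoeff (X \<kappa>) u)"
  by (cases "u = m") (simp_all add: vcoeff_def set_tf_coeff_def)

text \<open>Only coefficients of order below \<open>|m|\<close> enter, so those of multi-index \<open>m\<close> may be prescribed
  freely.\<close>

lemma lower_sum_set_tf_coeff:
  "lower_sum w R (set_tf_coeff x \<kappa> m v) (set_tf_coeff S \<kappa> m s) m \<kappa> = lower_sum w R x S m \<kappa>"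
  unfolding lower_sum_def
  by (intro sum.cong refl) (auto simp: vcoeff_set_tf_coeff lower_splits_def)

lemma scale_mat_mult: "scale_mat c A *v v = c *s (A *v v)"
  by (simp add: vec_eq_iff matrix_vector_mult_def map_matrix_def sum_distrib_left mult.assoc)

lemma D_mat_mult:
  "D_mat M C lam \<phi> L *v s =
    - (cmat C *v (\<Sum>j\<in>UNIV. s $ j *s \<phi> j) + cmat M *v (\<Sum>j\<in>UNIV. s $ j *s (lam j *s \<phi> j))
       + L *s (cmat M *v (\<Sum>j\<in>UNIV. s $ j *s \<phi> j)))"
proof -
  have "D_mat M C lam \<phi> L *v s =
      (\<Sum>j\<in>UNIV. s $ j *s (- ((cmat C + scale_mat (lam j + L) (cmat M)) *v \<phi> j)))"
    by (simp add: vec_eq_iff D_mat_def matrix_vector_mult_def[of "vec_lambda _"] mult.commute)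
  also have "\<dots> = - (\<Sum>j\<in>UNIV. s $ j *s (cmat C *v \<phi> j) + s $ j *s (lam j *s (cmat M *v \<phi> j))
      + L *s (s $ j *s (cmat M *v \<phi> j)))"
    unfolding sum_negf[symmetric]
    by (intro sum.cong refl)
       (simp add: matrix_vector_mult_add_rdistrib scale_mat_mult vec_eq_iff algebra_simps)
  also have "\<dots> = - (cmat C *v (\<Sum>j\<in>UNIV. s $ j *s \<phi> j)
      + cmat M *v (\<Sum>j\<in>UNIV. s $ j *s (lam j *s \<phi> j))
      + L *s (cmat M *v (\<Sum>j\<in>UNIV. s $ j *s \<phi> j)))"
    by (simp add: sum.distrib vec.sum vec.scale vec.scale_sum_right)
  finally show ?thesis .
qed

theorem lemma3:
  fixes M C K :: "real ^ 'n ^ 'n"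
    and f :: "(complex, 'n + 'n) mfps ^ 'n"
    and g :: "('q :: finite, 'n + 'n, 'n) taylor_fourier"
    and \<Omega> :: "real ^ 'q"
    and lam :: "'m :: finite \<Rightarrow> complex"
    and \<phi> :: "'m \<Rightarrow> complex ^ 'n"
    and w wd :: "(complex, 'm) mfps ^ 'n"
    and R :: "(complex, 'm) mfps ^ 'm"
    and x xd :: "('q, 'm, 'n) taylor_fourier"
    and S :: "('q, 'm, 'm) taylor_fourier"
    and m :: "nat ^ 'm" and \<kappa> :: "int ^ 'q"
    and x\<^sub>m :: "complex ^ 'n" and S\<^sub>m :: "complex ^ 'm"
  defines "L \<equiv> Lam lam \<Omega> m \<kappa>"
  assumes "\<And>\<nu>. mdeg \<nu> \<le> 1 \<Longrightarrow> vcoeff f \<nu> = 0"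
    and "even CARD('m)"
    and "\<And>j. \<exists>k. lam k = cnj (lam j)"
    and "\<And>j. \<phi> j \<noteq> 0"
    and "\<And>j. (scale_mat ((lam j)\<^sup>2) (cmat M) + scale_mat (lam j) (cmat C) + cmat K) *v \<phi> j = 0"
    and "vcoeff w 0 = 0" and "vcoeff wd 0 = 0" and "vcoeff R 0 = 0"
    and "\<And>j. vcoeff w (axis j 1) = \<phi> j"
    and "\<And>j. vcoeff wd (axis j 1) = lam j *s \<phi> j"
    and "\<And>i j. vcoeff R (axis j 1) $ i = (if i = j then lam j else 0)"
    and "autonomous_invariance M C K f (stack w wd) R"
  shows "(\<exists>xd\<^sub>m. let x' = set_tf_coeff x \<kappa> m x\<^sub>m; xd' = set_tf_coeff xd \<kappa> m xd\<^sub>m;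
              S' = set_tf_coeff S \<kappa> m S\<^sub>m; X' = (\<lambda>\<kappa>. stack (x' \<kappa>) (xd' \<kappa>)) in
            vcoeff (nonaut_lhs M C \<Omega> (stack w wd) R X' S' \<kappa>) m
            = vcoeff (nonaut_rhs M K f g (stack w wd) X' \<kappa>) m)
         \<longleftrightarrow> (cmat K + scale_mat L (cmat C) + scale_mat (L\<^sup>2) (cmat M)) *v x\<^sub>m
            = D_mat M C lam \<phi> L *v S\<^sub>m + C_vec M C f g w wd R x xd S L m \<kappa>"
proof -
  define W where "W = stack w wd"
  define V where "V = lower_sum w R x S m \<kappa>"
  define Vd where "Vd = lower_sum wd R xd S m \<kappa>"
  define p where "p = (\<Sum>j\<in>UNIV. S\<^sub>m $ j *s \<phi> j)"
  define pd where "pd = (\<Sum>j\<in>UNIV. S\<^sub>m $ j *s (lam j *s \<phi> j))"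
  \<comment> \<open>\<open>P\<close> is the position block of the differential expression; it does not depend on the
      velocity coefficient.\<close>
  define P where "P = V + p + L *s x\<^sub>m"
  define N where "N = vcoeff (compose_mat (jacobian (- f)) W *v stack (x \<kappa>) (xd \<kappa>)) m"
  define Gm where "Gm = vcoeff (compose_vec (g \<kappa>) W) m"
  have "coeff (w $ k) 0 = 0" "coeff (wd $ k) 0 = 0" for k
    using \<open>vcoeff w 0 = 0\<close> \<open>vcoeff wd 0 = 0\<close> by (simp_all add: vcoeff_def vec_eq_iff)
  then have W0: "coeff (W $ i) 0 = 0" for i
    by (cases i) (simp_all add: W_def)
  have F1: "vcoeff (- f) \<nu> = 0" if "mdeg \<nu> \<le> 1" for \<nu>
    using \<open>\<And>\<nu>. mdeg \<nu> \<le> 1 \<Longrightarrow> vcoeff f \<nu> = 0\<close>[OF that] by (simp add: vcoeff_def vec_eq_iff)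
  have coefficient_equation:
    "(let x' = set_tf_coeff x \<kappa> m x\<^sub>m; xd' = set_tf_coeff xd \<kappa> m xd\<^sub>m;
          S' = set_tf_coeff S \<kappa> m S\<^sub>m; X' = (\<lambda>\<kappa>. stack (x' \<kappa>) (xd' \<kappa>)) in
        vcoeff (nonaut_lhs M C \<Omega> (stack w wd) R X' S' \<kappa>) m
        = vcoeff (nonaut_rhs M K f g (stack w wd) X' \<kappa>) m)
     \<longleftrightarrow> cmat C *v P + cmat M *v (Vd + pd + L *s xd\<^sub>m) = - (cmat K *v x\<^sub>m) + N + Gm
        \<and> cmat M *v P = cmat M *v xd\<^sub>m" for xd\<^sub>m
  proof -
    define x' where "x' = set_tf_coeff x \<kappa> m x\<^sub>m"
    define xd' where "xd' = set_tf_coeff xd \<kappa> m xd\<^sub>m"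
    define S' where "S' = set_tf_coeff S \<kappa> m S\<^sub>m"
    note transport = vcoeff_transport[OF \<open>vcoeff R 0 = 0\<close>
        \<open>\<And>i j. vcoeff R (axis j 1) $ i = (if i = j then lam j else 0)\<close>]
    have pos: "vcoeff (jacobian w *v S' \<kappa> + jacobian (x' \<kappa>) *v R
        + phase_jacobian x' \<kappa> *v (\<chi> j. mconst (complex_of_real (\<Omega> $ j)))) m = P"
      unfolding transport
      by (simp add: P_def V_def p_def L_def x'_def S'_def lower_sum_set_tf_coeff
          vcoeff_set_tf_coeff \<open>\<And>j. vcoeff w (axis j 1) = \<phi> j\<close>
          del: One_nat_def)
    have vel: "vcoeff (jacobian wd *v S' \<kappa> + jacobian (xd' \<kappa>) *v R
        + phase_jacobian xd' \<kappa> *v (\<chi> j. mconst (complex_of_real (\<Omega> $ j)))) m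
        = Vd + pd + L *s xd\<^sub>m"
      unfolding transport
      by (simp add: Vd_def pd_def L_def xd'_def S'_def lower_sum_set_tf_coeff
          vcoeff_set_tf_coeff \<open>\<And>j. vcoeff wd (axis j 1) = lam j *s \<phi> j\<close>
          del: One_nat_def)
    have lhs: "vcoeff (nonaut_lhs M C \<Omega> (stack w wd) R (\<lambda>\<kappa>. stack (x' \<kappa>) (xd' \<kappa>)) S' \<kappa>) m
        = stack (cmat C *v P + cmat M *v (Vd + pd + L *s xd\<^sub>m)) (cmat M *v P)"
      unfolding nonaut_lhs_def vcoeff_smat_mult jacobian_stack_mult phase_jacobian_stack_mult
        stack_add vcoeff_stack pos vel B_mat_def cmat_block block_mult_stack
      by (simp add: cmat_zero_mult)
    have nonlin: "vcoeff (compose_mat (jacobian (- f)) W *v stack (x' \<kappa>) (xd' \<kappa>)) m = N"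
      unfolding N_def
      by (rule compose_jacobian_mult_cong[OF W0 F1])
         (simp_all add: vcoeff_stack x'_def xd'_def vcoeff_set_tf_coeff)
    have rhs: "vcoeff (nonaut_rhs M K f g (stack w wd) (\<lambda>\<kappa>. stack (x' \<kappa>) (xd' \<kappa>)) \<kappa>) m
        = stack (- (cmat K *v x\<^sub>m) + N + Gm) (cmat M *v xd\<^sub>m)"
    proof -
      have "vcoeff (nonaut_rhs M K f g (stack w wd) (\<lambda>\<kappa>. stack (x' \<kappa>) (xd' \<kappa>)) \<kappa>) m
        = stack (cmat (- K) *v x\<^sub>m + cmat 0 *v xd\<^sub>m) (cmat 0 *v x\<^sub>m + cmat M *v xd\<^sub>m)
          + stack N (vcoeff 0 m) + stack Gm (vcoeff 0 m)"
        unfolding nonaut_rhs_def vcoeff_add vcoeff_smat_mult F_ser_def G_ser_def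
          compose_jacobian_stack_mult compose_vec_stack compose_zero vcoeff_stack
          W_def[symmetric] nonlin Gm_def A_mat_def cmat_block block_mult_stack
        by (simp add: x'_def xd'_def vcoeff_set_tf_coeff)
      then show ?thesis
        by (simp add: stack_add stack_eq_iff cmat_zero_mult cmat_uminus_mult vcoeff_zero)
    qed
    show ?thesis
      unfolding Let_def x'_def[symmetric] xd'_def[symmetric] S'_def[symmetric] lhs rhs
        stack_eq_iff ..
  qed
  have C_vec: "C_vec M C f g w wd R x xd S L m \<kappa>
      = - (L *s (cmat M *v V)) - (cmat M *v Vd + cmat C *v V - N - Gm)"
    unfolding C_vec_def Y_vec_def Let_def F_ser_def upper_stack V_def Vd_def N_def Gm_def
      W_def vcoeff_compose_jacobian_mult[OF W0[unfolded W_def]]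
      vcoeff_compose_vec[OF W0[unfolded W_def]] ..
  \<comment> \<open>Eliminate the velocity: it occurs only as \<open>M xd\<^sub>m\<close>, which equals \<open>M P\<close>; the witness for
      the converse is \<open>xd\<^sub>m = P\<close>.\<close>
  have "(\<exists>xd\<^sub>m. cmat C *v P + cmat M *v (Vd + pd + L *s xd\<^sub>m) = - (cmat K *v x\<^sub>m) + N + Gm
        \<and> cmat M *v P = cmat M *v xd\<^sub>m)
    \<longleftrightarrow> cmat C *v P + cmat M *v Vd + cmat M *v pd + L *s (cmat M *v P)
        = - (cmat K *v x\<^sub>m) + N + Gm"
    by (auto simp: vec.add vec.scale add.assoc)
  also have "\<dots> \<longleftrightarrow> (cmat K + scale_mat L (cmat C) + scale_mat (L\<^sup>2) (cmat M)) *v x\<^sub>m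
      = D_mat M C lam \<phi> L *v S\<^sub>m + C_vec M C f g w wd R x xd S L m \<kappa>"
    unfolding C_vec D_mat_mult p_def[symmetric] pd_def[symmetric] P_def
      matrix_vector_mult_add_rdistrib scale_mat_mult vec.add vec.scale
    by (auto simp: vec_eq_iff algebra_simps power2_eq_square)
  finally show ?thesis unfolding coefficient_equation .
qed

end
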